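(* Let $n\ge 1$ be an integer and let $d=1$. Then the $(n,d)$ Delsarte linear program has a unique optimum, namely $A^*=(A_0^*,\dots,A_n^* )$ given by $A^*_i=\binom{n}{i}$ for all $0\le i\le n$. In addition, the dual linear program has a unique optimum, namely $c^*=(1,1,\dots,1)$ (all $n+1$ entries $c_0^*,\dots,c_n^*$ equal to $1$).
   Context: $[a,b]=\{x\in\mathbb{Z}: a\le x\le b\}$ and $[a]=\{1,\dots,a\}$ (empty if $a\le 0$). $\binom{a}{b}=0$ unless $0\le b\le a$. For $0\le i,j\le n$, the Krawtchouk polynomial is $K_j(i)=K_j(i;n)=\sum_{k=0}^j(-1)^k\binom{i}{k}\binom{n-i}{j-k}$. For integers $1\le d\le n$, the $(n,d)$ Delsarte linear program, in real variables $A=(A_0,\dots,A_n)$, is: maximize $\sum_{i=0}^n A_i$ subject to $\sum_{i=0}^n A_iK_j(i)\ge 0$ for all $j\in[n]$; $A_i=0$ for all $i\in[d-1]$; $A_0=1$; $A_i\ge 0$ for all $i\in[n]$. Its dual is the linear program in real variables $c=(c_0,\dots,c_n)$: minimize $\sum_{j=0}^n c_j\binom{n}{j}$ subject to $\sum_{j=0}^n c_jK_j(i)\le 0$ for all $i\in[d,n]$; $c_j\ge 0$ for all $j\in[n]$; $c_0=1$. An optimum is a feasible point achieving the optimal objective value. *)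

theory Defs
  imports Complex_Main "HOL-Library.FuncSet"
begin

text \<open>
  \<open>krawtchouk n j i\<close> is $K_j(i) = K_j(i;n)$, meant for \<open>i \<le> n\<close> and \<open>j \<le> n\<close>; outside this range
  the natural-number subtraction \<open>n - i\<close> truncates.
\<close>

definition krawtchouk :: "nat \<Rightarrow> nat \<Rightarrow> nat \<Rightarrow> real" where
  "krawtchouk n j i =
     (\<Sum>k=0..j. (-1) ^ k * real (i choose k) * real ((n - i) choose (j - k)))"

text \<open>
  A real vector indexed by \<open>0, \<dots>, n\<close> is an extensional function on \<open>{0..n}\<close> (it takes the value
  \<open>undefined\<close> outside \<open>{0..n}\<close>), so that two vectors are equal iff their \<open>n + 1\<close> entries agree.
\<close>

definition delsarte_feasible :: "nat \<Rightarrow> nat \<Rightarrow> (nat \<Rightarrow> real) \<Rightarrow> bool" where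
  "delsarte_feasible n d A \<longleftrightarrow>
     A \<in> {0..n} \<rightarrow>\<^sub>E UNIV \<and>
     (\<forall>j\<in>{1..n}. (\<Sum>i=0..n. A i * krawtchouk n j i) \<ge> 0) \<and>
     (\<forall>i\<in>{1..d-1}. A i = 0) \<and>
     A 0 = 1 \<and>
     (\<forall>i\<in>{1..n}. A i \<ge> 0)"

definition delsarte_objective :: "nat \<Rightarrow> (nat \<Rightarrow> real) \<Rightarrow> real" where
  "delsarte_objective n A = (\<Sum>i=0..n. A i)"

definition delsarte_optimum :: "nat \<Rightarrow> nat \<Rightarrow> (nat \<Rightarrow> real) \<Rightarrow> bool" where
  "delsarte_optimum n d A \<longleftrightarrow> is_arg_max (delsarte_objective n) (delsarte_feasible n d) A"

definition delsarte_dual_feasible :: "nat \<Rightarrow> nat \<Rightarrow> (nat \<Rightarrow> real) \<Rightarrow> bool" where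
  "delsarte_dual_feasible n d c \<longleftrightarrow>
     c \<in> {0..n} \<rightarrow>\<^sub>E UNIV \<and>
     (\<forall>i\<in>{d..n}. (\<Sum>j=0..n. c j * krawtchouk n j i) \<le> 0) \<and>
     (\<forall>j\<in>{1..n}. c j \<ge> 0) \<and>
     c 0 = 1"

definition delsarte_dual_objective :: "nat \<Rightarrow> (nat \<Rightarrow> real) \<Rightarrow> real" where
  "delsarte_dual_objective n c = (\<Sum>j=0..n. c j * real (n choose j))"

definition delsarte_dual_optimum :: "nat \<Rightarrow> nat \<Rightarrow> (nat \<Rightarrow> real) \<Rightarrow> bool" where
  "delsarte_dual_optimum n d c \<longleftrightarrow>
     is_arg_min (delsarte_dual_objective n) (delsarte_dual_feasible n d) c"

end

theory Submission
  imports Defs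
begin

text \<open>
  Writing \<open>K\<close> for the matrix with entries \<open>K\<^sub>j(i)\<close>, the whole argument rests on the involution
  \<open>K\<^sup>2 = 2\<^sup>n I\<close>, together with the two trivial boundary values \<open>K\<^sub>0(i) = 1\<close> and
  \<open>K\<^sub>j(0) = n choose j\<close>. The involution is read off the generating function
  \<open>\<Sum>\<^sub>j K\<^sub>j(i) x\<^sup>j y\<^sup>n\<^sup>-\<^sup>j = (y - x)\<^sup>i (y + x)\<^sup>n\<^sup>-\<^sup>i\<close>: the substitution \<open>x = 1 - z\<close>, \<open>y = 1 + z\<close>
  turns the right-hand side into \<open>2\<^sup>n z\<^sup>i\<close>.

  For the primal program put \<open>B\<^sub>j = \<Sum>\<^sub>i A\<^sub>i K\<^sub>j(i)\<close>. The objective is \<open>B\<^sub>0\<close>, the constraints are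
  \<open>B\<^sub>j \<ge> 0\<close> for \<open>j \<ge> 1\<close>, and inversion at index \<open>0\<close> reads \<open>\<Sum>\<^sub>j B\<^sub>j = 2\<^sup>n A\<^sub>0 = 2\<^sup>n\<close>. Hence
  \<open>B\<^sub>0 \<le> 2\<^sup>n\<close>, with equality only if \<open>B = (2\<^sup>n, 0, \<dots>, 0)\<close>; inverting this vector gives
  \<open>A\<^sub>l = n choose l\<close>.

  Dually, put \<open>D\<^sub>i = \<Sum>\<^sub>j c\<^sub>j K\<^sub>j(i)\<close>. Since \<open>d = 1\<close>, the constraints \<open>D\<^sub>i \<le> 0\<close> hold for every
  \<open>i \<ge> 1\<close>, the objective is \<open>D\<^sub>0\<close>, and inversion at index \<open>0\<close> reads
  \<open>\<Sum>\<^sub>i (n choose i) D\<^sub>i = 2\<^sup>n c\<^sub>0 = 2\<^sup>n\<close>. Hence \<open>D\<^sub>0 \<ge> 2\<^sup>n\<close>, with equality only if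
  \<open>D = (2\<^sup>n, 0, \<dots>, 0)\<close>, and inverting this vector gives \<open>c\<^sub>l = 1\<close>.
\<close>

lemma krawtchouk_0_left: "krawtchouk n 0 i = 1"
  by (simp add: krawtchouk_def)

lemma krawtchouk_0_right: "krawtchouk n j 0 = real (n choose j)"
proof -
  have "krawtchouk n j 0 = (\<Sum>k=0..j. if k = 0 then real (n choose j) else 0)"
    unfolding krawtchouk_def by (rule sum.cong) (auto simp: binomial_eq_0)
  then show ?thesis
    by simp
qed

text \<open>
  The homogeneous form matters: it is what allows substituting \<open>1 - z\<close> and \<open>1 + z\<close> for the two
  variables at every \<open>z\<close>, with no division by \<open>1 + z\<close>.
\<close>

lemma krawtchouk_generating_function:
  fixes x y :: real
  assumes "i \<le> n"
  shows "(\<Sum>j=0..n. krawtchouk n j i * x ^ j * y ^ (n - j)) = (y - x) ^ i * (y + x) ^ (n - i)"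
proof -
  define a where "a k = (-1) ^ k * real (i choose k) * y ^ (i - k)" for k
  define b where "b k = real (n - i choose k) * y ^ (n - i - k)" for k
  have "(y - x) ^ i = (\<Sum>k\<le>i. a k * x ^ k)"
    using binomial_ring[of "- x" y i]
    by (simp add: a_def power_minus[of x] mult_ac)
  moreover have "(y + x) ^ (n - i) = (\<Sum>k\<le>n - i. b k * x ^ k)"
    using binomial_ring[of x y "n - i"] by (simp add: b_def add.commute mult_ac)
  moreover have "(\<Sum>k\<le>i. a k * x ^ k) * (\<Sum>k\<le>n - i. b k * x ^ k) =
      (\<Sum>j\<le>i + (n - i). (\<Sum>k\<le>j. a k * b (j - k)) * x ^ j)"
    by (rule polynomial_product) (simp_all add: a_def b_def)
  moreover have "(\<Sum>k\<le>j. a k * b (j - k)) = krawtchouk n j i * y ^ (n - j)" if "j \<le> n" for j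
  proof -
    have "a k * b (j - k) =
        (-1) ^ k * real (i choose k) * real (n - i choose (j - k)) * y ^ (n - j)" if "k \<le> j" for k
    proof (cases "k \<le> i \<and> j - k \<le> n - i")
      case True
      then have "n - j = (i - k) + (n - i - (j - k))"
        using \<open>k \<le> j\<close> \<open>j \<le> n\<close> \<open>i \<le> n\<close> by linarith
      then show ?thesis
        by (simp add: a_def b_def power_add)
    next
      case False
      then show ?thesis
        by (auto simp: a_def b_def)
    qed
    then show ?thesis
      by (simp add: krawtchouk_def sum_distrib_right atMost_atLeast0)
  qed
  ultimately show ?thesis
    using assms by (simp add: atMost_atLeast0 mult_ac)
qed

text \<open>
  For fixed \<open>i\<close> both sides, as functions of \<open>l\<close>, are coefficient sequences of the same polynomial
  in \<open>z\<close>: summing first over \<open>l\<close> and then over \<open>j\<close> applies the generating function twice, and the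
  result is \<open>((1 + z) - (1 - z))\<^sup>i ((1 + z) + (1 - z))\<^sup>n\<^sup>-\<^sup>i = 2\<^sup>n z\<^sup>i\<close>.
\<close>

lemma krawtchouk_involution:
  assumes "i \<le> n" "l \<le> n"
  shows "(\<Sum>j=0..n. krawtchouk n j i * krawtchouk n l j) = (if l = i then 2 ^ n else 0)"
proof -
  have "(\<Sum>l\<le>n. (\<Sum>j=0..n. krawtchouk n j i * krawtchouk n l j) * z ^ l) =
      (\<Sum>l\<le>n. (if l = i then 2 ^ n else 0) * z ^ l)" for z :: real
  proof -
    have inner: "(\<Sum>l=0..n. krawtchouk n l j * z ^ l) = (1 - z) ^ j * (1 + z) ^ (n - j)"
      if "j \<le> n" for j
      using krawtchouk_generating_function[OF that, of z 1] by simp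
    have "(\<Sum>l\<le>n. (\<Sum>j=0..n. krawtchouk n j i * krawtchouk n l j) * z ^ l) =
        (\<Sum>j=0..n. krawtchouk n j i * (\<Sum>l=0..n. krawtchouk n l j * z ^ l))"
      unfolding sum_distrib_left sum_distrib_right atMost_atLeast0
      by (subst sum.swap) (simp add: mult_ac)
    also have "\<dots> = (\<Sum>j=0..n. krawtchouk n j i * (1 - z) ^ j * (1 + z) ^ (n - j))"
      by (rule sum.cong) (simp_all add: inner mult.assoc)
    also have "\<dots> = (2 * z) ^ i * 2 ^ (n - i)"
      using krawtchouk_generating_function[OF \<open>i \<le> n\<close>, of "1 - z" "1 + z"] by simp
    also have "\<dots> = 2 ^ n * z ^ i"
      using \<open>i \<le> n\<close> by (simp add: power_mult_distrib flip: power_add)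
    also have "\<dots> = (\<Sum>l\<le>n. if l = i then 2 ^ n * z ^ l else 0)"
      using \<open>i \<le> n\<close> by simp
    also have "\<dots> = (\<Sum>l\<le>n. (if l = i then 2 ^ n else 0) * z ^ l)"
      by (rule sum.cong) auto
    finally show ?thesis .
  qed
  then have "\<forall>l\<le>n. (\<Sum>j=0..n. krawtchouk n j i * krawtchouk n l j) = (if l = i then 2 ^ n else 0)"
    by (intro iffD1[OF polyfun_eq_coeffs] allI)
  then show ?thesis
    using \<open>l \<le> n\<close> by blast
qed

text \<open>
  In the primal constraints a vector is paired with the argument of \<open>K\<close>, in the dual constraints with
  its degree, so the involution is applied once as it stands and once transposed.
\<close>

lemma krawtchouk_inversion:
  assumes "l \<le> n"
  shows "(\<Sum>j=0..n. (\<Sum>i=0..n. A i * krawtchouk n j i) * krawtchouk n l j) = 2 ^ n * A l"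
proof -
  have "(\<Sum>j=0..n. (\<Sum>i=0..n. A i * krawtchouk n j i) * krawtchouk n l j) =
      (\<Sum>i=0..n. A i * (\<Sum>j=0..n. krawtchouk n j i * krawtchouk n l j))"
    unfolding sum_distrib_left sum_distrib_right by (subst sum.swap) (simp add: mult_ac)
  also have "\<dots> = (\<Sum>i=0..n. if i = l then 2 ^ n * A i else 0)"
    by (rule sum.cong) (auto simp: krawtchouk_involution assms)
  finally show ?thesis
    using assms by simp
qed

lemma krawtchouk_dual_inversion:
  assumes "l \<le> n"
  shows "(\<Sum>i=0..n. (\<Sum>j=0..n. c j * krawtchouk n j i) * krawtchouk n i l) = 2 ^ n * c l"
proof -
  have "(\<Sum>i=0..n. (\<Sum>j=0..n. c j * krawtchouk n j i) * krawtchouk n i l) =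
      (\<Sum>j=0..n. c j * (\<Sum>i=0..n. krawtchouk n i l * krawtchouk n j i))"
    unfolding sum_distrib_left sum_distrib_right by (subst sum.swap) (simp add: mult_ac)
  also have "\<dots> = (\<Sum>j=0..n. if j = l then 2 ^ n * c j else 0)"
    by (rule sum.cong) (auto simp: krawtchouk_involution assms)
  finally show ?thesis
    using assms by simp
qed

lemma delsarte_feasible_binomial:
  "delsarte_feasible n 1 (\<lambda>i\<in>{0..n}. real (n choose i))"
proof -
  have "(\<Sum>i=0..n. real (n choose i) * krawtchouk n j i) = 0" if "j \<in> {1..n}" for j
    using krawtchouk_involution[of 0 n j] that by (simp add: krawtchouk_0_right)
  then show ?thesis
    by (simp add: delsarte_feasible_def)
qed

lemma delsarte_objective_binomial:
  "delsarte_objective n (\<lambda>i\<in>{0..n}. real (n choose i)) = 2 ^ n"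
proof -
  have "real (\<Sum>i=0..n. n choose i) = 2 ^ n"
    unfolding atLeast0AtMost choose_row_sum by simp
  then show ?thesis
    by (simp add: delsarte_objective_def)
qed

text \<open>
  The entries of the transform \<open>B\<close> have fixed total \<open>2\<^sup>n\<close>, and the objective is one of them; the
  others are nonnegative. An optimal point leaves nothing for the others, which determines \<open>B\<close>
  and therefore, by inversion, \<open>A\<close>.
\<close>

lemma delsarte_objective_le:
  assumes "delsarte_feasible n 1 A"
  shows "delsarte_objective n A \<le> 2 ^ n"
    and "delsarte_objective n A = 2 ^ n \<Longrightarrow> A = (\<lambda>i\<in>{0..n}. real (n choose i))"
proof -
  define B where "B j = (\<Sum>i=0..n. A i * krawtchouk n j i)" for j
  have obj: "delsarte_objective n A = B 0"
    by (simp add: delsarte_objective_def B_def krawtchouk_0_left)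
  have nonneg: "\<forall>j\<in>{1..n}. B j \<ge> 0"
    using assms by (simp add: delsarte_feasible_def B_def)
  have total: "B 0 + (\<Sum>j=1..n. B j) = 2 ^ n"
    using krawtchouk_inversion[of 0 n A] assms
    by (simp add: delsarte_feasible_def krawtchouk_0_left sum.atLeast_Suc_atMost flip: B_def)
  show "delsarte_objective n A \<le> 2 ^ n"
    using total sum_nonneg[of "{1..n}" B] nonneg obj by simp
  show "A = (\<lambda>i\<in>{0..n}. real (n choose i))" if "delsarte_objective n A = 2 ^ n"
  proof (rule extensionalityI[of _ "{0..n}"])
    have zero: "\<forall>j\<in>{1..n}. B j = 0"
      using total obj that nonneg sum_nonneg_eq_0_iff[of "{1..n}" B] by simp
    fix l assume "l \<in> {0..n}"
    then have "2 ^ n * A l = (\<Sum>j=0..n. B j * krawtchouk n l j)"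
      by (simp add: krawtchouk_inversion B_def)
    also have "\<dots> = 2 ^ n * real (n choose l)"
      using zero obj that by (simp add: sum.atLeast_Suc_atMost krawtchouk_0_right)
    finally show "A l = (\<lambda>i\<in>{0..n}. real (n choose i)) l"
      using \<open>l \<in> {0..n}\<close> by simp
  qed (use assms in \<open>auto simp: delsarte_feasible_def PiE_def\<close>)
qed

lemma delsarte_dual_feasible_one:
  "delsarte_dual_feasible n 1 (\<lambda>j\<in>{0..n}. 1)"
proof -
  have "(\<Sum>j=0..n. krawtchouk n j i) = 0" if "i \<in> {1..n}" for i
    using krawtchouk_involution[of i n 0] that by (simp add: krawtchouk_0_left)
  then show ?thesis
    by (simp add: delsarte_dual_feasible_def)
qed

lemma delsarte_dual_objective_one:
  "delsarte_dual_objective n (\<lambda>j\<in>{0..n}. 1) = 2 ^ n"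
  using delsarte_objective_binomial[of n]
  by (simp add: delsarte_dual_objective_def delsarte_objective_def)

text \<open>
  The same scheme with weights: the fixed quantity is \<open>\<Sum>\<^sub>i (n choose i) D\<^sub>i\<close>, in which the
  objective \<open>D\<^sub>0\<close> has weight \<open>1\<close>. Equality forces every \<open>D\<^sub>i\<close> with \<open>i \<ge> 1\<close> to vanish because
  all the weights are positive.
\<close>

lemma delsarte_dual_objective_ge:
  assumes "delsarte_dual_feasible n 1 c"
  shows "delsarte_dual_objective n c \<ge> 2 ^ n"
    and "delsarte_dual_objective n c = 2 ^ n \<Longrightarrow> c = (\<lambda>j\<in>{0..n}. 1)"
proof -
  define D where "D i = (\<Sum>j=0..n. c j * krawtchouk n j i)" for i
  have obj: "delsarte_dual_objective n c = D 0"
    by (simp add: delsarte_dual_objective_def D_def krawtchouk_0_right)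
  have nonneg: "\<forall>i\<in>{1..n}. - (D i * real (n choose i)) \<ge> 0"
    using assms by (simp add: delsarte_dual_feasible_def D_def mult_nonpos_nonneg)
  have total: "D 0 = 2 ^ n + (\<Sum>i=1..n. - (D i * real (n choose i)))"
    using krawtchouk_dual_inversion[of 0 n c] assms
    by (simp add: delsarte_dual_feasible_def krawtchouk_0_right sum.atLeast_Suc_atMost sum_negf
        flip: D_def)
  show "delsarte_dual_objective n c \<ge> 2 ^ n"
    using total sum_nonneg[of "{1..n}" "\<lambda>i. - (D i * real (n choose i))"] nonneg obj by simp
  show "c = (\<lambda>j\<in>{0..n}. 1)" if "delsarte_dual_objective n c = 2 ^ n"
  proof (rule extensionalityI[of _ "{0..n}"])
    have "\<forall>i\<in>{1..n}. - (D i * real (n choose i)) = 0"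
      using total obj that nonneg
        sum_nonneg_eq_0_iff[of "{1..n}" "\<lambda>i. - (D i * real (n choose i))"] by simp
    then have zero: "\<forall>i\<in>{1..n}. D i = 0"
      by simp
    fix l assume "l \<in> {0..n}"
    then have "2 ^ n * c l = (\<Sum>i=0..n. D i * krawtchouk n i l)"
      by (simp add: krawtchouk_dual_inversion D_def)
    also have "\<dots> = 2 ^ n"
      using zero obj that by (simp add: sum.atLeast_Suc_atMost krawtchouk_0_left)
    finally show "c l = (\<lambda>j\<in>{0..n}. 1) l"
      using \<open>l \<in> {0..n}\<close> by simp
  qed (use assms in \<open>auto simp: delsarte_dual_feasible_def PiE_def\<close>)
qed

theorem theorem3p6:
  fixes n d :: nat
  assumes "n \<ge> 1" and "d = 1"
  shows "(\<forall>A. delsarte_optimum n d A \<longleftrightarrow> A = (\<lambda>i\<in>{0..n}. real (n choose i))) \<and>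
         (\<forall>c. delsarte_dual_optimum n d c \<longleftrightarrow> c = (\<lambda>j\<in>{0..n}. 1))"
proof (intro conjI allI iffI)
  fix A
  assume opt: "delsarte_optimum n d A"
  then have feas: "delsarte_feasible n 1 A"
    using assms by (simp add: delsarte_optimum_def is_arg_max_def)
  have "\<not> delsarte_objective n A < 2 ^ n"
    using opt delsarte_feasible_binomial[of n] delsarte_objective_binomial[of n] \<open>d = 1\<close>
    unfolding delsarte_optimum_def is_arg_max_def by metis
  then show "A = (\<lambda>i\<in>{0..n}. real (n choose i))"
    using delsarte_objective_le[OF feas] by simp
next
  fix A
  assume "A = (\<lambda>i\<in>{0..n}. real (n choose i))"
  then show "delsarte_optimum n d A"
    using delsarte_feasible_binomial[of n] delsarte_objective_binomial[of n]
      delsarte_objective_le(1)[of n] \<open>d = 1\<close>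
    unfolding delsarte_optimum_def is_arg_max_def by (metis not_less)
next
  fix c
  assume opt: "delsarte_dual_optimum n d c"
  then have feas: "delsarte_dual_feasible n 1 c"
    using assms by (simp add: delsarte_dual_optimum_def is_arg_min_def)
  have "\<not> 2 ^ n < delsarte_dual_objective n c"
    using opt delsarte_dual_feasible_one[of n] delsarte_dual_objective_one[of n] \<open>d = 1\<close>
    unfolding delsarte_dual_optimum_def is_arg_min_def by metis
  then show "c = (\<lambda>j\<in>{0..n}. 1)"
    using delsarte_dual_objective_ge[OF feas] by simp
next
  fix c :: "nat \<Rightarrow> real"
  assume "c = (\<lambda>j\<in>{0..n}. 1)"
  then show "delsarte_dual_optimum n d c"
    using delsarte_dual_feasible_one[of n] delsarte_dual_objective_one[of n]
      delsarte_dual_objective_ge(1)[of n] \<open>d = 1\<close>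
    unfolding delsarte_dual_optimum_def is_arg_min_def by (metis not_less)
qed

end
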